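(* For $n\ge1$ and $0\le p\le n-1$ let $X_{n,p}$ be the number of configurations of size $n$ in which exactly $p$ other pairs are excluded by the given pair, and let $\mathcal X_n(p)=X_{n,p}/(n\,(2n-1)!!)$. Define the asymptotic distribution $\mathcal X(x)=\lim_{n\to\infty}(n-1)\,\mathcal X_n\bigl((n-1)x\bigr)$ for $x=\lim_{n\to\infty}p/(n-1)\in[0,1]$. Then $$\mathcal X(x)=\begin{cases}\pi/2, & 0\le x<1/2,\\ \pi/2-2\tan^{-1}\sqrt{2x-1}, & 1/2\le x\le 1.\end{cases}$$
   Context: Fix $n\ge1$. A configuration (of size $n$) is a perfect matching of the $2n$ points $1,2,\dots,2n$ (laid out on a line) into $n$ unordered pairs, together with one distinguished pair, called the given pair; the other $n-1$ pairs are treated as indistinguishable, so there are $n\,(2n-1)!!$ configurations. Let the given pair be $\{g<h\}$ and let $\{a<b\}$ be another pair. The pair $\{a,b\}$ is excluded by the given pair if $b<g$ or $a>h$. *)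

theory Defs
  imports "HOL-Analysis.Analysis" "HOL-Library.Disjoint_Sets"
begin

definition perfect_matching :: "nat \<Rightarrow> nat set set \<Rightarrow> bool" where
  "perfect_matching n M \<longleftrightarrow> partition_on {1..2 * n} M \<and> (\<forall>e\<in>M. card e = 2)"

text \<open>A configuration is a matching together with its given pair.\<close>

definition configurations :: "nat \<Rightarrow> (nat set set \<times> nat set) set" where
  "configurations n = {(M, G). perfect_matching n M \<and> G \<in> M}"

text \<open>For pairs \<open>G = {g < h}\<close> and \<open>e = {a < b}\<close>, this says \<open>b < g\<close> or \<open>a > h\<close>.\<close>

definition excluded_by :: "nat set \<Rightarrow> nat set \<Rightarrow> bool" where
  "excluded_by G e \<longleftrightarrow> Max e < Min G \<or> Min e > Max G"

definition num_excluded :: "nat set set \<Rightarrow> nat set \<Rightarrow> nat" where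
  "num_excluded M G = card {e \<in> M - {G}. excluded_by G e}"

definition X_count :: "nat \<Rightarrow> nat \<Rightarrow> nat" where
  "X_count n p = card {(M, G) \<in> configurations n. num_excluded M G = p}"

fun double_fact :: "nat \<Rightarrow> nat" where
  "double_fact 0 = 1"
| "double_fact (Suc 0) = 1"
| "double_fact (Suc (Suc n)) = Suc (Suc n) * double_fact n"

definition X_dist :: "nat \<Rightarrow> nat \<Rightarrow> real" where
  "X_dist n p = real (X_count n p) / real (n * double_fact (2 * n - 1))"

end

(*
Let m = n - 1. Removing the given pair {g < h} leaves a matching of 2m points coloured 0 (left of g),
1 (between g and h) or 2 (right of h), and a pair is excluded iff it is monochromatic of colour 0
or 2. The number of such matchings depends only on the sizes i, j, k of the colour classes, and every
(i, j, k) with i + j + k = 2m occurs for exactly one pair {g < h}. Hence X_{n,p} is a sum over all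
3-colourings of 2m points, weighted by i! j! k! / (2m)!. By the Dirichlet integral, this weight is
(2m + 1) (2m + 2) times the integral of x^i y^j z^k over the simplex x + y + z = 1, so the
points may be coloured independently with probabilities x, y, z: each of the m pairs of a fixed matching
is then excluded independently with probability x^2 + z^2.

In the coordinates x = a v, z = a (1 - v), whose Jacobian is a, the success probability is a^2 q(v)
with q(v) = v^2 + (1 - v)^2 (side_prob below). Integrating the binomial probability over a gives
n X_n(p) = int_0^1 P(Bin(n, q(v)) > p) / q(v) dv. By Chebyshev's inequality and dominated convergence
this tends to the integral of 1 / q over {v. q(v) > x}, and arctan (2 v - 1) is an antiderivative of 1 / q.
*)

theory Submission
  imports Defs
begin

section \<open>Weighted colourings of a fixed matching\<close>

definition matchings :: "'a set \<Rightarrow> 'a set set set" where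
  "matchings A = {M. partition_on A M \<and> (\<forall>e\<in>M. card e = 2)}"

text \<open>Colours 0, 1, 2 stand for left of, between and right of the points of the given pair,
  so pairs of colour 1 are deliberately left out.\<close>

definition monochromatic :: "('a \<Rightarrow> nat) \<Rightarrow> 'a set set \<Rightarrow> 'a set set" where
  "monochromatic c M = {e \<in> M. (\<forall>a\<in>e. c a = 0) \<or> (\<forall>a\<in>e. c a = 2)}"

definition colourings :: "'a set \<Rightarrow> ('a \<Rightarrow> nat) set" where
  "colourings A = A \<rightarrow>\<^sub>E {0, 1, 2}"

lemma finite_colourings: "finite A \<Longrightarrow> finite (colourings A)"
  unfolding colourings_def by (intro finite_PiE) auto

lemma finite_matchings: "finite A \<Longrightarrow> finite (matchings A)"
  by (rule finite_subset[of _ "Pow (Pow A)"])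
    (auto simp: matchings_def partition_on_def)

lemma sum_colourings_insert:
  assumes "a \<notin> A"
  shows "sum f (colourings (insert a A)) =
    (\<Sum>c\<in>colourings A. \<Sum>y\<in>{0, 1, 2}. f (c(a := y)))"
proof -
  have "sum f (colourings (insert a A)) =
      (\<Sum>(y, c)\<in>{0, 1, 2} \<times> colourings A. f (c(a := y)))"
    unfolding colourings_def PiE_insert_eq
    by (subst sum.reindex[OF inj_combinator[OF assms]])
      (auto simp: case_prod_unfold intro!: sum.cong)
  also have "\<dots> = (\<Sum>y\<in>{0, 1, 2}. \<Sum>c\<in>colourings A. f (c(a := y)))"
    by (simp add: sum.cartesian_product)
  finally show ?thesis by (subst sum.swap)
qed

text \<open>The pairs of \<open>M\<close> are disjoint, so their colours are chosen independently:
  each pair carries total weight \<open>(w 0 + w 1 + w 2) ^ 2\<close>, of which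
  \<open>w 0 ^ 2 + w 2 ^ 2\<close> falls on the monochromatic choices. For weights adding up to 1
  this is a binomial probability. Adding one pair at a time turns it into Pascal's rule.\<close>

lemma sum_colourings_monochromatic:
  fixes w :: "nat \<Rightarrow> real"
  assumes "finite M" "disjoint M" "\<And>e. e \<in> M \<Longrightarrow> card e = 2"
  shows "(\<Sum>c | c \<in> colourings (\<Union>M) \<and> card (monochromatic c M) = p. \<Prod>a\<in>\<Union>M. w (c a)) =
    real (card M choose p) * (w 0 ^ 2 + w 2 ^ 2) ^ p *
      ((w 0 + w 1 + w 2) ^ 2 - (w 0 ^ 2 + w 2 ^ 2)) ^ (card M - p)"
proof -
  define s where "s = w 0 ^ 2 + w 2 ^ 2"
  define r where "r = (w 0 + w 1 + w 2) ^ 2 - s"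
  define F where "F M p c = (if card (monochromatic c M) = p then \<Prod>a\<in>\<Union>M. w (c a) else 0)"
    for M :: "'a set set" and p c
  have "(\<Sum>c\<in>colourings (\<Union>M). F M p c) = real (card M choose p) * s ^ p * r ^ (card M - p)"
    using assms
  proof (induction M arbitrary: p rule: finite_induct)
    case empty
    then show ?case by (cases p) (auto simp: colourings_def F_def monochromatic_def)
  next
    case (insert e M)
    obtain a b where e: "e = {a, b}" "a \<noteq> b"
      using insert.prems by (meson card_2_iff insertI1)
    have disj: "e \<inter> f = {}" if "f \<in> M" for f
      using insert.prems(1) insert.hyps(2) that by (auto simp: disjoint_def)
    have ab: "a \<notin> \<Union>M" "b \<notin> \<Union>M"
      using disj e by auto
    have fin: "finite (\<Union>M)"
      using insert.hyps(1) insert.prems(2) by (metis card.infinite finite_Union insertI2 zero_neq_numeral)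
    have U: "\<Union>(insert e M) = insert a (insert b (\<Union>M))"
      using e by auto
    have mono: "monochromatic (c(b := z, a := y)) (insert e M) =
        (if y = z \<and> y \<in> {0, 2} then insert e (monochromatic c M) else monochromatic c M)" for c y z
    proof -
      let ?c = "c(b := z, a := y)"
      define P where "P c f \<longleftrightarrow> (\<forall>d\<in>f. c d = 0) \<or> (\<forall>d\<in>f. c d = 2)"
        for c :: "'a \<Rightarrow> nat" and f
      have mono_P: "monochromatic c N = {f \<in> N. P c f}" for c N
        by (simp add: monochromatic_def P_def)
      have old: "P ?c f \<longleftrightarrow> P c f" if "f \<in> M" for f
      proof -
        have "?c d = c d" if "d \<in> f" for d
          using ab that \<open>f \<in> M\<close> by auto
        then show ?thesis by (simp add: P_def)
      qed
      have new: "P ?c e \<longleftrightarrow> y = z \<and> y \<in> {0, 2}"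
        using e by (auto simp: P_def)
      have "monochromatic ?c (insert e M) =
          (if P ?c e then insert e {f \<in> M. P ?c f} else {f \<in> M. P ?c f})"
        unfolding mono_P by auto
      also have "{f \<in> M. P ?c f} = monochromatic c M"
        unfolding mono_P using old by auto
      finally show ?thesis unfolding new .
    qed
    have card: "card (monochromatic (c(b := z, a := y)) (insert e M)) =
        (if y = z \<and> y \<in> {0, 2} then Suc (card (monochromatic c M))
         else card (monochromatic c M))" for c y z
      unfolding mono using insert.hyps by (auto simp: monochromatic_def)
    have prod: "(\<Prod>d\<in>insert a (insert b (\<Union>M)). w ((c(b := z, a := y)) d)) =
        w y * w z * (\<Prod>d\<in>\<Union>M. w (c d))" for c y z
    proof -
      have "(\<Prod>d\<in>\<Union>M. w ((c(b := z, a := y)) d)) = (\<Prod>d\<in>\<Union>M. w (c d))"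
        using ab by (intro prod.cong) auto
      then show ?thesis using e ab fin by (simp add: algebra_simps)
    qed
    \<comment> \<open>Of the nine colourings of the new pair, the two with both points 0 or both
      points 2 have total weight \<open>s\<close> and raise the count by one; the other seven have
      total weight \<open>r\<close> and leave it unchanged.\<close>
    have step: "(\<Sum>z\<in>{0,1,2}. \<Sum>y\<in>{0,1,2}. F (insert e M) p (c(b := z, a := y))) =
        r * F M p c + s * (if p = 0 then 0 else F M (p - 1) c)" for c p
      unfolding F_def card U prod
      by (auto simp: r_def s_def power2_eq_square algebra_simps)
    have rec: "(\<Sum>c\<in>colourings (\<Union>(insert e M)). F (insert e M) p c) =
        r * (\<Sum>c\<in>colourings (\<Union>M). F M p c) +
        s * (if p = 0 then 0 else \<Sum>c\<in>colourings (\<Union>M). F M (p - 1) c)" for p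
    proof -
      have "(\<Sum>c\<in>colourings (insert a (insert b (\<Union>M))). F (insert e M) p c) =
          (\<Sum>c\<in>colourings (\<Union>M). \<Sum>z\<in>{0,1,2}. \<Sum>y\<in>{0,1,2}. F (insert e M) p (c(b := z, a := y)))"
        using ab e by (simp only: sum_colourings_insert insert_iff simp_thms)
      then show ?thesis
        unfolding step U by (auto simp: sum.distrib sum_distrib_left)
    qed
    have IH: "(\<Sum>c\<in>colourings (\<Union>M). F M p c) = real (card M choose p) * s ^ p * r ^ (card M - p)" for p
      using insert.IH insert.prems by (simp add: disjoint_def)
    show ?case
    proof (cases p)
      case 0
      then show ?thesis unfolding rec IH using insert.hyps by simp
    next
      case (Suc k)
      \<comment> \<open>The powers of \<open>r\<close> match only for
        \<open>Suc k \<le> card M\<close>; beyond that subtraction truncates, but the binomial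
        coefficient is 0.\<close>
      have "r * (real (card M choose Suc k) * s ^ Suc k * r ^ (card M - Suc k)) =
          real (card M choose Suc k) * s ^ Suc k * r ^ (card M - k)"
      proof (cases "Suc k \<le> card M")
        case True
        then have "r ^ (card M - k) = r * r ^ (card M - Suc k)"
          by (metis Suc_diff_le diff_Suc_Suc power_Suc)
        then show ?thesis by simp
      qed (simp add: binomial_eq_0)
      then show ?thesis unfolding rec IH using insert.hyps Suc
        by (simp add: algebra_simps)
    qed
  qed
  moreover have "(\<Sum>c | c \<in> colourings (\<Union>M) \<and> card (monochromatic c M) = p. \<Prod>a\<in>\<Union>M. w (c a)) =
      (\<Sum>c\<in>colourings (\<Union>M). F M p c)"
    unfolding F_def using assms
    by (subst sum.inter_filter[symmetric])
      (metis card.infinite finite_Union finite_colourings zero_neq_numeral, simp)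
  ultimately show ?thesis unfolding r_def s_def by simp
qed

section \<open>Counting matchings by removing one pair\<close>

lemma card_matching:
  assumes "finite A" "M \<in> matchings A"
  shows "2 * card M = card A"
proof -
  have "card A = (\<Sum>e\<in>M. card e)"
    using assms card_Union_disjoint[of M]
    by (auto simp: matchings_def partition_on_def disjoint_def pairwise_def disjnt_def
        dest: finite_UnionD intro: finite_subset[OF Union_upper])
  also have "\<dots> = 2 * card M"
    using assms(2) by (simp add: matchings_def)
  finally show ?thesis ..
qed

text \<open>Serves twice: for the recursion of the number of matchings, and for sorting
  configurations by their given pair. Reinserting \<open>G\<close> undoes the removal because a
  nonempty \<open>G\<close> cannot be a block of a partition of \<open>A - G\<close>.\<close>

lemma bij_betw_remove_pair:
  "bij_betw (\<lambda>(M, G). (G, M - {G})) {(M, G). M \<in> matchings A \<and> G \<in> M}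
    (SIGMA G:{G. G \<subseteq> A \<and> card G = 2}. matchings (A - G))"
proof (rule bij_betw_byWitness[where f' = "\<lambda>(G, M). (insert G M, G)"])
  have notin: "G \<notin> M" if "card G = 2" "M \<in> matchings (A - G)" for G :: "'a set" and M
  proof
    assume "G \<in> M"
    then have "G \<subseteq> A - G"
      using that by (auto simp: matchings_def partition_on_def)
    then have "G = {}" by auto
    then show False using that by simp
  qed
  show "\<forall>x\<in>{(M, G). M \<in> matchings A \<and> G \<in> M}.
      (case case x of (M, G) \<Rightarrow> (G, M - {G}) of (G, M) \<Rightarrow> (insert G M, G)) = x"
    by auto
  show "\<forall>x\<in>SIGMA G:{G. G \<subseteq> A \<and> card G = 2}. matchings (A - G).
      (case case x of (G, M) \<Rightarrow> (insert G M, G) of (M, G) \<Rightarrow> (G, M - {G})) = x"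
    using notin by auto
  show "(\<lambda>(M, G). (G, M - {G})) ` {(M, G). M \<in> matchings A \<and> G \<in> M}
      \<subseteq> (SIGMA G:{G. G \<subseteq> A \<and> card G = 2}. matchings (A - G))"
  proof
    fix x assume "x \<in> (\<lambda>(M, G). (G, M - {G})) ` {(M, G). M \<in> matchings A \<and> G \<in> M}"
    then obtain M G where x: "x = (G, M - {G})" and M: "M \<in> matchings A" "G \<in> M"
      by auto
    have U: "\<Union>M = A" using M(1) by (simp add: matchings_def partition_on_def)
    have "e \<inter> G = {}" if "e \<in> M - {G}" for e
      using M that by (auto simp: matchings_def partition_on_def disjoint_def)
    then have "\<Union>(M - {G}) = A - G" unfolding U[symmetric] by blast
    then have "M - {G} \<in> matchings (A - G)"
      using M(1) by (auto simp: matchings_def partition_on_def disjoint_def)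
    moreover have "G \<subseteq> A" "card G = 2"
      using M U by (auto simp: matchings_def)
    ultimately show "x \<in> (SIGMA G:{G. G \<subseteq> A \<and> card G = 2}. matchings (A - G))"
      by (simp add: x)
  qed
  show "(\<lambda>(G, M). (insert G M, G)) ` (SIGMA G:{G. G \<subseteq> A \<and> card G = 2}. matchings (A - G))
      \<subseteq> {(M, G). M \<in> matchings A \<and> G \<in> M}"
  proof clarsimp
    fix G M assume G: "G \<subseteq> A" "card G = 2" and M: "M \<in> matchings (A - G)"
    have "e \<inter> G = {}" if "e \<in> M" for e
      using M that by (auto simp: matchings_def partition_on_def)
    then show "insert G M \<in> matchings A"
      using G M by (auto simp: matchings_def partition_on_def disjoint_def)
  qed
qed

text \<open>Double counting of matchings with a marked pair: by the matching, each has
  \<open>Suc m\<close> choices of a mark; by the marked pair, each of the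
  \<open>2 * Suc m choose 2\<close> pairs leaves a matching problem on \<open>2 * m\<close>
  points.\<close>

lemma card_matchings:
  assumes "finite A" "card A = 2 * m"
  shows "card (matchings A) = double_fact (2 * m - 1)"
  using assms
proof (induction m arbitrary: A)
  case 0
  then have "matchings A = {{}}"
    by (auto simp: matchings_def partition_on_def)
  then show ?case by simp
next
  case (Suc m)
  have "card {(M, G). M \<in> matchings A \<and> G \<in> M} = card (SIGMA M:matchings A. M)"
    by (intro arg_cong[of _ _ card]) auto
  also have "\<dots> = (\<Sum>M\<in>matchings A. card M)"
    using Suc.prems finite_matchings[of A]
    by (intro card_SigmaI) (auto simp: matchings_def intro: finite_elements)
  also have "\<dots> = (\<Sum>M\<in>matchings A. Suc m)"
  proof (rule sum.cong)
    fix M assume "M \<in> matchings A"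
    from card_matching[OF Suc.prems(1) this] show "card M = Suc m"
      using Suc.prems(2) by simp
  qed simp
  finally have left: "card {(M, G). M \<in> matchings A \<and> G \<in> M} = card (matchings A) * Suc m"
    by simp
  let ?P = "{G. G \<subseteq> A \<and> card G = 2}"
  have fin: "finite ?P"
    using Suc.prems by (auto intro: finite_subset[of _ "Pow A"])
  have "card (SIGMA G:?P. matchings (A - G)) = (\<Sum>G\<in>?P. card (matchings (A - G)))"
    using Suc.prems fin by (intro card_SigmaI) (auto intro: finite_matchings)
  also have "\<dots> = (\<Sum>G\<in>?P. double_fact (2 * m - 1))"
    using Suc.prems
    by (intro sum.cong refl Suc.IH) (auto simp: card_Diff_subset finite_subset)
  also have "\<dots> = (2 * Suc m choose 2) * double_fact (2 * m - 1)"
    using n_subsets[OF Suc.prems(1), of 2] Suc.prems by simp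
  also have "2 * Suc m choose 2 = Suc m * (2 * m + 1)"
    by (simp add: choose_two algebra_simps)
  finally have "card (matchings A) * Suc m = Suc m * (2 * m + 1) * double_fact (2 * m - 1)"
    using bij_betw_same_card[OF bij_betw_remove_pair[of A]] left by simp
  then have "card (matchings A) = (2 * m + 1) * double_fact (2 * m - 1)"
    unfolding mult.assoc mult.commute[of _ "Suc m"] by (simp only: Suc_mult_cancel1)
  \<comment> \<open>For \<open>m = 0\<close> the argument \<open>2 * m - 1\<close> truncates to 0,
    so the defining recursion of \<open>double_fact\<close> does not apply and this case is
    separate.\<close>
  also have "\<dots> = double_fact (2 * Suc m - 1)"
    by (cases m) auto
  finally show ?case .
qed

section \<open>Dependence on the sizes of the colour classes alone\<close>

definition num_matchings :: "'a set \<Rightarrow> ('a \<Rightarrow> nat) \<Rightarrow> nat \<Rightarrow> nat" where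
  "num_matchings A c p = card {M \<in> matchings A. card (monochromatic c M) = p}"

text \<open>A colour-preserving bijection transports matchings injectively and keeps the
  monochromatic pairs. An inequality suffices, since the inverse bijection supplies the other
  direction.\<close>

lemma num_matchings_le:
  assumes "finite A" and f: "bij_betw f A B" and c: "\<And>a. a \<in> A \<Longrightarrow> d (f a) = c a"
  shows "num_matchings A c p \<le> num_matchings B d p"
proof -
  let ?F = "(`) ((`) f)"
  have inj: "inj_on f A" and B: "B = f ` A"
    using f by (auto simp: bij_betw_def)
  have inj': "inj_on ((`) f) (Pow A)"
    by (rule inj_on_image_Pow[OF inj])
  have inj'': "inj_on ?F (Pow (Pow A))"
    by (rule inj_on_image_Pow[OF inj'])
  have "?F M \<in> matchings B" if M: "M \<in> matchings A" for M
  proof -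
    have part: "partition_on A M" using M by (simp add: matchings_def)
    have "partition_on B ((`) f ` M - {{}})"
      unfolding B by (rule partition_on_inj_image[OF part inj])
    moreover have "{} \<notin> (`) f ` M"
      using part by (auto simp: partition_on_def)
    moreover have "card (f ` e) = 2" if "e \<in> M" for e
    proof -
      have "e \<subseteq> A" using that part by (auto simp: partition_on_def)
      then show ?thesis
        using M that inj by (auto simp: matchings_def card_image inj_on_subset)
    qed
    ultimately show ?thesis by (auto simp: matchings_def)
  qed
  moreover have "card (monochromatic d (?F M)) = card (monochromatic c M)"
    if M: "M \<in> matchings A" for M
  proof -
    have sub: "e \<subseteq> A" if "e \<in> M" for e
      using M that by (auto simp: matchings_def partition_on_def)
    have all: "(\<forall>b\<in>f ` e. d b = i) \<longleftrightarrow> (\<forall>a\<in>e. c a = i)" if "e \<in> M" for e i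
      using sub[OF that] c by (metis imageE image_eqI subsetD)
    have "monochromatic d (?F M) = (`) f ` {e \<in> M. (\<forall>b\<in>f ` e. d b = 0) \<or> (\<forall>b\<in>f ` e. d b = 2)}"
      by (auto simp: monochromatic_def)
    also have "\<dots> = (`) f ` monochromatic c M"
      unfolding monochromatic_def using all by (intro arg_cong[of _ _ "image _"] Collect_cong)
        (simp only: all cong: conj_cong)
    finally have "monochromatic d (?F M) = (`) f ` monochromatic c M" .
    moreover have "inj_on ((`) f) (monochromatic c M)"
      using sub by (intro inj_on_subset[OF inj']) (auto simp: monochromatic_def)
    ultimately show ?thesis by (simp add: card_image)
  qed
  moreover have "finite B" using assms by (simp add: B)
  ultimately have into: "?F ` {M \<in> matchings A. card (monochromatic c M) = p}
      \<subseteq> {M \<in> matchings B. card (monochromatic d M) = p}"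
    and fin: "finite {M \<in> matchings B. card (monochromatic d M) = p}"
    using finite_matchings[of B] by auto
  have "{M \<in> matchings A. card (monochromatic c M) = p} \<subseteq> Pow (Pow A)"
    by (auto simp: matchings_def partition_on_def)
  from card_inj_on_le[OF inj_on_subset[OF inj'' this] into fin] show ?thesis
    by (simp add: num_matchings_def)
qed

text \<open>Bijections between the fibres of equal colour are glued to one colour-preserving
  bijection from \<open>A\<close> to \<open>B\<close>.\<close>

lemma num_matchings_cong:
  assumes "finite A" "finite B"
    and fibres: "\<And>i. card {a \<in> A. c a = i} = card {b \<in> B. d b = i}"
  shows "num_matchings A c p = num_matchings B d p"
proof -
  have "\<exists>g. bij_betw g {a \<in> A. c a = i} {b \<in> B. d b = i}" for i
    using assms by (intro finite_same_card_bij) auto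
  then obtain g where g: "\<And>i. bij_betw (g i) {a \<in> A. c a = i} {b \<in> B. d b = i}"
    by metis
  define f where "f a = g (c a) a" for a
  have fA: "f a \<in> B \<and> d (f a) = c a" if "a \<in> A" for a
    using bij_betwE[OF g[of "c a"]] that by (auto simp: f_def)
  have "inj_on f A"
  proof (rule inj_onI)
    fix a b assume ab: "a \<in> A" "b \<in> A" "f a = f b"
    then have "c a = c b" using fA by metis
    then show "a = b"
      using ab bij_betw_imp_inj_on[OF g[of "c a"]] by (auto simp: f_def inj_on_def)
  qed
  moreover have "B \<subseteq> f ` A"
  proof
    fix b assume "b \<in> B"
    then have "b \<in> g (d b) ` {a \<in> A. c a = d b}"
      unfolding bij_betw_imp_surj_on[OF g] by simp
    then obtain a where "a \<in> A" "f a = b"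
      by (auto simp: f_def)
    then show "b \<in> f ` A" by blast
  qed
  ultimately have f: "bij_betw f A B"
    using fA by (auto simp: bij_betw_def)
  have "num_matchings A c p \<le> num_matchings B d p"
    using assms f fA by (intro num_matchings_le) auto
  moreover have "num_matchings B d p \<le> num_matchings A c p"
  proof (rule num_matchings_le[OF \<open>finite B\<close> bij_betw_inv_into[OF f]])
    fix b assume "b \<in> B"
    then have "inv_into A f b \<in> A" "f (inv_into A f b) = b"
      using f by (auto simp: bij_betw_def f_inv_into_f inv_into_into)
    then show "c (inv_into A f b) = d b" using fA by metis
  qed
  ultimately show ?thesis by simp
qed

text \<open>Choose the points of colour 0, then those of colour 2 among the rest; colour 1 is forced
  on the remainder. The product is a multinomial coefficient.\<close>

lemma card_colourings_fibres:
  assumes "finite A"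
  shows "card {c \<in> colourings A. card {a \<in> A. c a = 0} = i \<and> card {a \<in> A. c a = 2} = k} =
    (card A choose i) * ((card A - i) choose k)"
proof -
  let ?C = "{c \<in> colourings A. card {a \<in> A. c a = 0} = i \<and> card {a \<in> A. c a = 2} = k}"
  let ?S = "SIGMA L:{L. L \<subseteq> A \<and> card L = i}. {R. R \<subseteq> A - L \<and> card R = k}"
  have "bij_betw (\<lambda>c. ({a \<in> A. c a = 0}, {a \<in> A. c a = 2})) ?C ?S"
  proof (rule bij_betw_byWitness[where f' = "\<lambda>(L, R). restrict (\<lambda>a. if a \<in> L then 0 else if a \<in> R then 2 else (1::nat)) A"],
      goal_cases)
    case 1
    show ?case
    proof
      fix c assume "c \<in> ?C"
      then have "c \<in> A \<rightarrow>\<^sub>E {0, 1, 2}" by (simp add: colourings_def)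
      then show "(case ({a \<in> A. c a = 0}, {a \<in> A. c a = 2}) of (L, R) \<Rightarrow>
          \<lambda>a\<in>A. if a \<in> L then 0 else if a \<in> R then 2 else 1) = c"
        by (intro ext) (auto simp: PiE_iff extensional_def)
    qed
  next
    case 2
    show ?case by auto
  next
    case 3
    show ?case by auto
  next
    case 4
    show ?case
    proof
      fix c
      assume "c \<in> (\<lambda>(L, R). \<lambda>a\<in>A. if a \<in> L then 0 else if a \<in> R then 2 else (1::nat)) ` ?S"
      then obtain L R where LR: "L \<subseteq> A" "card L = i" "R \<subseteq> A - L" "card R = k"
        and c: "c = (\<lambda>a\<in>A. if a \<in> L then 0 else if a \<in> R then 2 else 1)"
        by auto
      have "c a = 0 \<longleftrightarrow> a \<in> L" "c a = 2 \<longleftrightarrow> a \<in> R" if "a \<in> A" for a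
        using LR(3) that by (auto simp: c)
      then have "{a \<in> A. c a = 0} = L" "{a \<in> A. c a = 2} = R"
        using LR by auto
      moreover have "c \<in> colourings A"
        unfolding c colourings_def by auto
      ultimately show "c \<in> ?C" using LR by simp
    qed
  qed
  then have "card ?C = card ?S" by (rule bij_betw_same_card)
  also have "\<dots> = (\<Sum>L | L \<subseteq> A \<and> card L = i. card {R. R \<subseteq> A - L \<and> card R = k})"
    using assms
    by (intro card_SigmaI ballI) (auto intro: finite_subset[of _ "Pow A"])
  also have "\<dots> = (\<Sum>L | L \<subseteq> A \<and> card L = i. (card A - i) choose k)"
    using assms
    by (intro sum.cong refl) (auto simp: n_subsets card_Diff_subset finite_subset)
  finally show ?thesis using assms by (simp add: n_subsets)
qed

section \<open>From configurations to coloured matchings\<close>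

text \<open>The two points of \<open>G\<close> would also get colour 1; this is harmless, as the
  matchings counted below live on the points outside \<open>G\<close>.\<close>

definition side_colour :: "nat set \<Rightarrow> nat \<Rightarrow> nat" where
  "side_colour G a = (if a < Min G then 0 else if Max G < a then 2 else 1)"

lemma excluded_eq_monochromatic:
  assumes "finite G" "G \<noteq> {}" "M \<in> matchings A"
  shows "{e \<in> M. excluded_by G e} = monochromatic (side_colour G) M"
proof -
  have G: "Min G \<le> Max G"
    using assms by simp
  have "excluded_by G e \<longleftrightarrow> (\<forall>a\<in>e. side_colour G a = 0) \<or> (\<forall>a\<in>e. side_colour G a = 2)"
    if "e \<in> M" for e
  proof -
    have e: "finite e" "e \<noteq> {}"
      using assms(3) that by (auto simp: matchings_def intro: card_ge_0_finite)
    have "Max e < Min G \<longleftrightarrow> (\<forall>a\<in>e. side_colour G a = 0)"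
      unfolding Max_less_iff[OF e] by (auto simp: side_colour_def)
    moreover have "Min e > Max G \<longleftrightarrow> (\<forall>a\<in>e. side_colour G a = 2)"
      unfolding Min_gr_iff[OF e] using G by (auto simp: side_colour_def)
    ultimately show ?thesis unfolding excluded_by_def by blast
  qed
  then show ?thesis by (auto simp: monochromatic_def)
qed

text \<open>Configurations are sorted by their given pair. Removing it loses nothing, because
  \<open>num_excluded\<close> already leaves \<open>G\<close> out.\<close>

lemma X_count_eq_sum_pairs:
  "X_count n p = (\<Sum>G | G \<subseteq> {1..2 * n} \<and> card G = 2.
    num_matchings ({1..2 * n} - G) (side_colour G) p)"
proof -
  let ?A = "{1..2 * n}"
  let ?F = "\<lambda>(M, G). (G, M - {G})"
  let ?S = "SIGMA G:{G. G \<subseteq> ?A \<and> card G = 2}.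
      {M \<in> matchings (?A - G). card (monochromatic (side_colour G) M) = p}"
  let ?C = "{(M, G) \<in> configurations n. num_excluded M G = p}"
  have conf: "configurations n = {(M, G). M \<in> matchings ?A \<and> G \<in> M}"
    by (auto simp: configurations_def perfect_matching_def matchings_def)
  have bij: "bij_betw ?F (configurations n)
      (SIGMA G:{G. G \<subseteq> ?A \<and> card G = 2}. matchings (?A - G))"
    unfolding conf by (rule bij_betw_remove_pair)
  have num: "num_excluded M G = card (monochromatic (side_colour G) (M - {G}))"
    if "(M, G) \<in> configurations n" for M G
  proof -
    have F: "?F (M, G) \<in> (SIGMA G:{G. G \<subseteq> ?A \<and> card G = 2}. matchings (?A - G))"
      using bij_betwE[OF bij] that by blast
    then have "finite G" "G \<noteq> {}"
      by (auto intro: finite_subset)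
    with F show ?thesis
      unfolding num_excluded_def by (subst excluded_eq_monochromatic) auto
  qed
  have "?F ` ?C = ?S"
  proof (intro set_eqI iffI)
    fix x assume "x \<in> ?F ` ?C"
    then obtain M G where MG: "(M, G) \<in> configurations n" "num_excluded M G = p" "x = ?F (M, G)"
      by auto
    then show "x \<in> ?S"
      using bij_betwE[OF bij] num by force
  next
    fix x assume x: "x \<in> ?S"
    then have "x \<in> ?F ` configurations n"
      unfolding bij_betw_imp_surj_on[OF bij] by auto
    then obtain M G where "(M, G) \<in> configurations n" "x = ?F (M, G)"
      by auto
    then show "x \<in> ?F ` ?C"
      using x num by force
  qed
  moreover have "inj_on ?F ?C"
    by (rule inj_on_subset[OF bij_betw_imp_inj_on[OF bij]]) auto
  ultimately have "X_count n p = card ?S"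
    unfolding X_count_def using card_image by fastforce
  also have "\<dots> = (\<Sum>G | G \<subseteq> ?A \<and> card G = 2.
      card {M \<in> matchings (?A - G). card (monochromatic (side_colour G) M) = p})"
    by (intro card_SigmaI) (auto intro: finite_subset[of _ "Pow ?A"] simp: finite_matchings)
  finally show ?thesis by (simp add: num_matchings_def)
qed

text \<open>A pair \<open>{g, h}\<close> with \<open>g < h\<close> is encoded by the number
  \<open>i = g - 1\<close> of points to its left and the number \<open>k\<close> of points to its
  right; \<open>g < h\<close> then reads \<open>i + k \<le> 2 * m\<close>.\<close>

lemma X_count_eq_sum_sizes:
  "X_count (Suc m) p = (\<Sum>(i, k) | i + k \<le> 2 * m.
    num_matchings ({1..2 * Suc m} - {Suc i, 2 * Suc m - k}) (side_colour {Suc i, 2 * Suc m - k}) p)"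
proof -
  let ?h = "\<lambda>(i, k). {Suc i, 2 * Suc m - k}"
  have "bij_betw ?h {(i, k). i + k \<le> 2 * m} {G. G \<subseteq> {1..2 * Suc m} \<and> card G = 2}"
  proof (rule bij_betw_byWitness[where f' = "\<lambda>G. (Min G - 1, 2 * Suc m - Max G)"])
    show "\<forall>x\<in>{(i, k). i + k \<le> 2 * m}. (Min (?h x) - 1, 2 * Suc m - Max (?h x)) = x"
      by auto
    have pair: "\<exists>g h. G = {g, h} \<and> 1 \<le> g \<and> g < h \<and> h \<le> 2 * Suc m"
      if "G \<subseteq> {1..2 * Suc m}" "card G = 2" for G :: "nat set"
    proof -
      obtain g h where "G = {g, h}" "g \<noteq> h" using \<open>card G = 2\<close> card_2_iff by metis
      then show ?thesis
        using that(1) by (cases g h rule: linorder_cases) (auto simp: insert_commute)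
    qed
    show "\<forall>G\<in>{G. G \<subseteq> {1..2 * Suc m} \<and> card G = 2}. ?h (Min G - 1, 2 * Suc m - Max G) = G"
    proof
      fix G :: "nat set" assume "G \<in> {G. G \<subseteq> {1..2 * Suc m} \<and> card G = 2}"
      then obtain g h where "G = {g, h}" "1 \<le> g" "g < h" "h \<le> 2 * Suc m"
        using pair by blast
      then show "?h (Min G - 1, 2 * Suc m - Max G) = G"
        by (simp add: min_def max_def)
    qed
    show "?h ` {(i, k). i + k \<le> 2 * m} \<subseteq> {G. G \<subseteq> {1..2 * Suc m} \<and> card G = 2}"
      by (auto simp: card_insert_if)
    show "(\<lambda>G. (Min G - 1, 2 * Suc m - Max G)) ` {G. G \<subseteq> {1..2 * Suc m} \<and> card G = 2}
        \<subseteq> {(i, k). i + k \<le> 2 * m}"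
    proof
      fix x assume "x \<in> (\<lambda>G. (Min G - 1, 2 * Suc m - Max G)) ` {G. G \<subseteq> {1..2 * Suc m} \<and> card G = 2}"
      then obtain g h where "x = (Min {g, h} - 1, 2 * Suc m - Max {g, h})"
        "1 \<le> g" "g < h" "h \<le> 2 * Suc m"
        using pair by blast
      then show "x \<in> {(i, k). i + k \<le> 2 * m}"
        by (auto simp: min_def max_def)
    qed
  qed
  from sum.reindex_bij_betw[OF this,
      of "\<lambda>G. num_matchings ({1..2 * Suc m} - G) (side_colour G) p"]
  show ?thesis
    unfolding X_count_eq_sum_pairs by (simp add: case_prod_unfold)
qed

lemma card_fibres:
  assumes "finite A" "c \<in> colourings A"
  shows "card {a \<in> A. c a = 0} + card {a \<in> A. c a = 1} + card {a \<in> A. c a = 2} = card A"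
proof -
  have range: "c a \<in> {0, 1, 2}" if "a \<in> A" for a
    using assms(2) that unfolding colourings_def by (rule PiE_mem)
  have "A = {a \<in> A. c a = 0} \<union> {a \<in> A. c a = 1} \<union> {a \<in> A. c a = 2}"
    using range by auto
  then have "card A = card ({a \<in> A. c a = 0} \<union> {a \<in> A. c a = 1} \<union> {a \<in> A. c a = 2})"
    by simp
  also have "\<dots> = card {a \<in> A. c a = 0} + card {a \<in> A. c a = 1} + card {a \<in> A. c a = 2}"
    using assms(1) by (subst card_Un_disjoint; (subst card_Un_disjoint)?) auto
  finally show ?thesis ..
qed

text \<open>Links a colouring of an abstract set to the one given pair whose left and right sides
  have the same sizes. The bound on \<open>i + k\<close> ensures that \<open>Suc i\<close> lies
  before \<open>2 * Suc m - k\<close>, so that the middle class also has the right size.\<close>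

lemma num_matchings_eq_side_colour:
  assumes "finite A" "card A = 2 * m" "c \<in> colourings A"
    and "i = card {a \<in> A. c a = 0}" "k = card {a \<in> A. c a = 2}"
  shows "i + k \<le> 2 * m"
    and "num_matchings A c p = num_matchings ({1..2 * Suc m} - {Suc i, 2 * Suc m - k})
      (side_colour {Suc i, 2 * Suc m - k}) p"
proof -
  let ?B = "{1..2 * Suc m} - {Suc i, 2 * Suc m - k}"
  let ?d = "side_colour {Suc i, 2 * Suc m - k}"
  have range: "c a \<in> {0, 1, 2}" if "a \<in> A" for a
    using assms(3) that unfolding colourings_def by (rule PiE_mem)
  have one: "card {a \<in> A. c a = 1} = 2 * m - i - k" and le: "i + k \<le> 2 * m"
    using card_fibres[OF assms(1,3)] assms(2,4,5) by auto
  show "i + k \<le> 2 * m" by fact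
  have "card {a \<in> A. c a = j} = card {b \<in> ?B. ?d b = j}" for j
  proof -
    consider "j = 0" | "j = 1" | "j = 2" | "j \<notin> {0, 1, 2}" by auto
    then show ?thesis
    proof cases
      case 1
      have "{b \<in> ?B. ?d b = 0} = {1..i}"
        using le by (auto simp: side_colour_def)
      then show ?thesis using 1 assms(4) by simp
    next
      case 2
      have "{b \<in> ?B. ?d b = 1} = {i + 2..<2 * Suc m - k}"
        using le by (auto simp: side_colour_def)
      then show ?thesis using 2 one by simp
    next
      case 3
      have "{b \<in> ?B. ?d b = 2} = {2 * Suc m - k<..2 * Suc m}"
        using le by (auto simp: side_colour_def)
      then show ?thesis using 3 assms(5) le by simp
    next
      case 4
      then have "{a \<in> A. c a = j} = {}"
        using range by blast
      moreover have "{b \<in> ?B. ?d b = j} = {}"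
        using 4 by (auto simp: side_colour_def)
      ultimately show ?thesis by (simp only: card.empty)
    qed
  qed
  then show "num_matchings A c p = num_matchings ?B ?d p"
    using assms(1) by (intro num_matchings_cong) auto
qed

section \<open>The count as a weighted sum over all colourings\<close>

text \<open>For \<open>c\<close> in \<open>colourings A\<close>, an inverse multinomial coefficient:
  the weights of all colourings with the same class sizes add up to 1.\<close>

definition size_weight :: "'a set \<Rightarrow> ('a \<Rightarrow> nat) \<Rightarrow> real" where
  "size_weight A c = (\<Prod>i\<in>{0, 1, 2}. fact (card {a \<in> A. c a = i})) / fact (card A)"

text \<open>The weight lets each size pair \<open>(i, k)\<close> count once although many colourings
  share it. In exchange the matching can be fixed first and the colouring summed afterwards, where
  the pairs become independent.\<close>

lemma X_count_eq_weighted_sum: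
  assumes "finite A" "card A = 2 * m"
  shows "real (X_count (Suc m) p) =
    (\<Sum>M\<in>matchings A. \<Sum>c | c \<in> colourings A \<and> card (monochromatic c M) = p. size_weight A c)"
proof -
  let ?S = "{(i, k). i + k \<le> 2 * m}"
  let ?N = "\<lambda>(i, k). real (num_matchings ({1..2 * Suc m} - {Suc i, 2 * Suc m - k})
      (side_colour {Suc i, 2 * Suc m - k}) p)"
  let ?g = "\<lambda>c. (card {a \<in> A. c a = 0}, card {a \<in> A. c a = 2})"
  have finC: "finite (colourings A)"
    using assms by (simp add: finite_colourings)
  have finM: "finite (matchings A)"
    using assms by (simp add: finite_matchings)
  have finS: "finite ?S"
    by (rule finite_subset[of _ "{..2 * m} \<times> {..2 * m}"]) auto
  have "(\<Sum>M\<in>matchings A. \<Sum>c | c \<in> colourings A \<and> card (monochromatic c M) = p. size_weight A c)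
      = (\<Sum>c\<in>colourings A. \<Sum>M\<in>matchings A.
          if card (monochromatic c M) = p then size_weight A c else 0)"
    using finC by (subst sum.swap) (simp add: sum.inter_filter)
  also have "\<dots> = (\<Sum>c\<in>colourings A. real (num_matchings A c p) * size_weight A c)"
    using finM by (simp add: sum.inter_filter[symmetric] num_matchings_def)
  also have "\<dots> = (\<Sum>c\<in>colourings A. ?N (?g c) * size_weight A c)"
    using num_matchings_eq_side_colour(2)[OF assms] by (intro sum.cong) auto
  \<comment> \<open>Colourings are grouped by class sizes, on which both factors depend
    alone.\<close>
  also have "\<dots> = (\<Sum>x\<in>?S. \<Sum>c | c \<in> colourings A \<and> ?g c = x. ?N (?g c) * size_weight A c)"
    using num_matchings_eq_side_colour(1)[OF assms]
    by (intro sum.group[symmetric] finC finS) auto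
  also have "\<dots> = (\<Sum>x\<in>?S. ?N x)"
  proof (rule sum.cong[OF refl])
    fix x assume x: "x \<in> ?S"
    obtain i k where ik: "x = (i, k)" "i + k \<le> 2 * m" using x by auto
    have "size_weight A c = fact i * fact (2 * m - i - k) * fact k / fact (2 * m)"
      if "c \<in> colourings A" "?g c = x" for c
    proof -
      have "card {a \<in> A. c a = 0} = i" "card {a \<in> A. c a = 2} = k"
        using that(2) ik by auto
      moreover from this have "card {a \<in> A. c a = 1} = 2 * m - i - k"
        using card_fibres[OF assms(1) that(1)] assms(2) by simp
      ultimately show ?thesis
        by (simp add: size_weight_def assms(2))
    qed
    then have "(\<Sum>c | c \<in> colourings A \<and> ?g c = x. ?N (?g c) * size_weight A c) =
        (\<Sum>c | c \<in> colourings A \<and> ?g c = x.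
          ?N x * (fact i * fact (2 * m - i - k) * fact k / fact (2 * m)))"
      by (intro sum.cong) auto
    also have "\<dots> = real (card {c \<in> colourings A. ?g c = x}) *
          (?N x * (fact i * fact (2 * m - i - k) * fact k / fact (2 * m)))"
      by simp
    also have "card {c \<in> colourings A. ?g c = x} = (2 * m choose i) * (2 * m - i choose k)"
      using card_colourings_fibres[OF assms(1), of i k] assms(2) ik by simp
    also have "real \<dots> * (?N x * (fact i * fact (2 * m - i - k) * fact k / fact (2 * m))) = ?N x"
      using ik by (simp add: binomial_fact)
    finally show "(\<Sum>c | c \<in> colourings A \<and> ?g c = x. ?N (?g c) * size_weight A c) = ?N x" .
  qed
  also have "\<dots> = real (X_count (Suc m) p)"
    unfolding X_count_eq_sum_sizes by (simp add: case_prod_unfold)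
  finally show ?thesis ..
qed

section \<open>Beta and Dirichlet integrals\<close>

text \<open>Euler's beta integral. The induction is integration by parts:
  \<open>u ^ Suc i * (1 - u) ^ Suc j\<close> vanishes at both ends, so its derivative integrates to
  0 and one factor \<open>1 - u\<close> is traded for a factor \<open>u\<close>.\<close>

lemma beta_integral:
  "((\<lambda>u::real. u ^ i * (1 - u) ^ j) has_integral fact i * fact j / fact (i + j + 1)) {0..1}"
proof (induction j arbitrary: i)
  case 0
  have "((\<lambda>u::real. u ^ i) has_integral 1 ^ Suc i / real (Suc i) - 0 ^ Suc i / real (Suc i)) {0..1}"
  proof (intro fundamental_theorem_of_calculus)
    fix u :: real
    have "((\<lambda>u. u ^ Suc i / real (Suc i)) has_real_derivative u ^ i) (at u within {0..1})"
      using DERIV_cdivide[OF DERIV_pow[of "Suc i" u], of "real (Suc i)"] by simp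
    then show "((\<lambda>u. u ^ Suc i / real (Suc i)) has_vector_derivative u ^ i) (at u within {0..1})"
      by (simp only: has_real_derivative_iff_has_vector_derivative)
  qed simp
  also have "1 ^ Suc i / real (Suc i) - 0 ^ Suc i / real (Suc i) = fact i * fact 0 / fact (i + 0 + 1)"
    by simp
  finally show ?case by simp
next
  case (Suc j)
  let ?F = "\<lambda>u::real. u ^ Suc i * (1 - u) ^ Suc j"
  have "((\<lambda>u. real (Suc i) * (u ^ i * (1 - u) ^ Suc j) - real (Suc j) * (u ^ Suc i * (1 - u) ^ j))
      has_integral ?F 1 - ?F 0) {0..1}"
  proof (intro fundamental_theorem_of_calculus)
    fix u :: real
    have pow: "((\<lambda>u. u ^ Suc i) has_real_derivative real (Suc i) * u ^ i) (at u within {0..1})"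
      using DERIV_pow[of "Suc i" u] by simp
    have pow': "((\<lambda>u. (1 - u) ^ Suc j) has_real_derivative - (real (Suc j) * (1 - u) ^ j))
        (at u within {0..1})"
      by (rule DERIV_cong[OF DERIV_chain2[OF DERIV_pow[of "Suc j"] DERIV_diff[OF DERIV_const DERIV_ident]]])
        simp
    show "(?F has_vector_derivative
        real (Suc i) * (u ^ i * (1 - u) ^ Suc j) - real (Suc j) * (u ^ Suc i * (1 - u) ^ j))
        (at u within {0..1})"
      unfolding has_real_derivative_iff_has_vector_derivative[symmetric]
      by (rule DERIV_cong[OF DERIV_mult[OF pow pow']]) (simp only: mult_ac add_uminus_conv_diff mult_minus_right mult_minus_left)
  qed simp
  from has_integral_add[OF this has_integral_mult_right[OF Suc.IH[of "Suc i"], of "real (Suc j)"]]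
  have "((\<lambda>u. real (Suc i) * (u ^ i * (1 - u) ^ Suc j)) has_integral
      real (Suc j) * (fact (Suc i) * fact j / fact (Suc i + j + 1))) {0..1}"
    by simp
  from has_integral_mult_right[OF this, of "inverse (real (Suc i))"]
  moreover have "inverse (real (Suc i)) * (real (Suc j) * (fact (Suc i) * fact j / fact (Suc i + j + 1))) =
      fact i * fact (Suc j) / fact (i + Suc j + 1)"
  proof -
    have cancel: "inverse c * (d * (c * x * y / z)) = x * (d * y) / z" if "c \<noteq> 0" for c d x y z :: real
      using that by simp
    show ?thesis
      unfolding fact_Suc of_nat_mult of_nat_fact by (subst cancel) auto
  qed
  moreover have "inverse (real (Suc i)) * (real (Suc i) * x) = x" for x
    by simp
  ultimately show ?case by (simp only:)
qed

lemma prod_colouring: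
  fixes w :: "nat \<Rightarrow> real"
  assumes "finite A" "c \<in> colourings A"
  shows "(\<Prod>a\<in>A. w (c a)) = (\<Prod>i\<in>{0, 1, 2}. w i ^ card {a \<in> A. c a = i})"
proof -
  have "c ` A \<subseteq> {0, 1, 2}"
    using PiE_mem[OF assms(2)[unfolded colourings_def]] by (rule image_subsetI)
  then have "(\<Prod>a\<in>A. w (c a)) = (\<Prod>i\<in>{0, 1, 2}. \<Prod>a | a \<in> A \<and> c a = i. w (c a))"
    using assms(1) by (subst prod.group) simp_all
  also have "\<dots> = (\<Prod>i\<in>{0, 1, 2}. w i ^ card {a \<in> A. c a = i})"
  proof (rule prod.cong)
    fix i
    have "(\<Prod>a | a \<in> A \<and> c a = i. w (c a)) = (\<Prod>a | a \<in> A \<and> c a = i. w i)"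
      by (rule prod.cong) simp_all
    then show "(\<Prod>a | a \<in> A \<and> c a = i. w (c a)) = w i ^ card {a \<in> A. c a = i}"
      by simp
  qed simp
  finally show ?thesis .
qed

text \<open>Colour probabilities on the simplex: \<open>a\<close> is the probability of not having
  colour 1, and \<open>v\<close> the share of colour 0 in it.\<close>

definition simplex_weight :: "real \<Rightarrow> real \<Rightarrow> nat \<Rightarrow> real" where
  "simplex_weight v a i = (if i = 0 then a * v else if i = 1 then 1 - a else a * (1 - v))"

text \<open>With \<open>v\<close> fixed this is a beta integral in \<open>a\<close>; the leading
  factor \<open>a\<close>, the Jacobian, accounts for the \<open>+ 1\<close> in the first
  factorial.\<close>

lemma inner_dirichlet_integral:
  assumes "finite A" "c \<in> colourings A"
  shows "((\<lambda>a. a * (\<Prod>x\<in>A. simplex_weight v a (c x))) has_integral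
    v ^ card {x \<in> A. c x = 0} * (1 - v) ^ card {x \<in> A. c x = 2} *
      (fact (card {x \<in> A. c x = 0} + card {x \<in> A. c x = 2} + 1) *
       fact (card {x \<in> A. c x = 1}) / fact (card A + 2))) {0..1}"
proof -
  define i j k where "i = card {x \<in> A. c x = 0}" "j = card {x \<in> A. c x = 1}"
    and "k = card {x \<in> A. c x = 2}"
  note ijk = this
  have n: "card A = i + j + k"
    using card_fibres[OF assms] by (simp add: ijk)
  have "((\<lambda>a. v ^ i * (1 - v) ^ k * (a ^ (i + k + 1) * (1 - a) ^ j)) has_integral
      v ^ i * (1 - v) ^ k * (fact (i + k + 1) * fact j / fact (i + k + 1 + j + 1))) {0..1}"
    by (intro has_integral_mult_right beta_integral)
  also have "i + k + 1 + j + 1 = card A + 2"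
    using n by simp
  also have "(\<lambda>a. v ^ i * (1 - v) ^ k * (a ^ (i + k + 1) * (1 - a) ^ j)) =
      (\<lambda>a. a * (\<Prod>x\<in>A. simplex_weight v a (c x)))"
    unfolding prod_colouring[OF assms]
    by (auto simp: simplex_weight_def ijk power_mult_distrib power_add)
  finally show ?thesis
    by (simp only: ijk)
qed

text \<open>The remaining beta integral in \<open>v\<close> cancels the factorial of
  \<open>i + k + 1\<close> left by the inner one. Working with an iterated integral avoids any
  change of variables in the plane.\<close>

lemma dirichlet_integral:
  assumes "finite A" "c \<in> colourings A"
  shows "((\<lambda>v. integral {0..1} (\<lambda>a. a * (\<Prod>x\<in>A. simplex_weight v a (c x)))) has_integral
    size_weight A c / (real (card A + 1) * real (card A + 2))) {0..1}"
proof -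
  define i j k where "i = card {x \<in> A. c x = 0}" "j = card {x \<in> A. c x = 1}"
    and "k = card {x \<in> A. c x = 2}"
  note ijk = this
  have "((\<lambda>v::real. (fact (i + k + 1) * fact j / fact (card A + 2)) * (v ^ i * (1 - v) ^ k)) has_integral
      (fact (i + k + 1) * fact j / fact (card A + 2)) * (fact i * fact k / fact (i + k + 1))) {0..1}"
    by (intro has_integral_mult_right beta_integral)
  also have "(fact (i + k + 1) * fact j / fact (card A + 2)) * (fact i * fact k / fact (i + k + 1)) =
      size_weight A c / (real (card A + 1) * real (card A + 2))"
    by (simp add: size_weight_def ijk field_simps del: One_nat_def)
  also have "(\<lambda>v. (fact (i + k + 1) * fact j / fact (card A + 2)) * (v ^ i * (1 - v) ^ k)) =
      (\<lambda>v. integral {0..1} (\<lambda>a. a * (\<Prod>x\<in>A. simplex_weight v a (c x))))"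
    using inner_dirichlet_integral[OF assms, THEN integral_unique]
    by (simp add: ijk mult_ac)
  finally show ?thesis .
qed

section \<open>Binomial tails and the exact integral formula\<close>

text \<open>For \<open>x\<close> in the unit interval, the probability that a binomial variable with
  \<open>n\<close> trials and success probability \<open>x\<close> is strictly larger than
  \<open>p\<close>.\<close>

definition binomial_tail :: "nat \<Rightarrow> nat \<Rightarrow> real \<Rightarrow> real" where
  "binomial_tail n p x = (\<Sum>k\<in>{p<..n}. Bernstein n k x)"

text \<open>The derivative of \<open>Bernstein (Suc m) (Suc k)\<close> is \<open>Suc m\<close> times
  the difference of two neighbouring polynomials of degree \<open>m\<close>, so the sum telescopes;
  its upper end vanishes because \<open>m choose Suc m\<close> is 0.\<close>

lemma DERIV_binomial_tail:
  assumes "p \<le> m"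
  shows "(binomial_tail (Suc m) p has_real_derivative real (Suc m) * Bernstein m p x) (at x)"
proof -
  have der: "(Bernstein (Suc m) (Suc k) has_real_derivative
      real (Suc m) * (Bernstein m k x - Bernstein m (Suc k) x)) (at x)" if "k \<le> m" for k
  proof -
    have 1: "real (Suc m choose Suc k) * real (Suc k) = real (Suc m) * real (m choose k)"
      by (metis Suc_times_binomial_eq of_nat_mult)
    have 2: "real (Suc m choose Suc k) * real (m - k) = real (Suc m) * real (m choose Suc k)"
      using binomial_absorb_comp[of "Suc m" "Suc k"]
      by (metis diff_Suc_1 diff_Suc_Suc mult.commute of_nat_mult)
    have "(Bernstein (Suc m) (Suc k) has_real_derivative
      real (Suc m choose Suc k) * real (Suc k) * (x ^ k * (1 - x) ^ (m - k)) -
      real (Suc m choose Suc k) * real (m - k) * (x ^ Suc k * (1 - x) ^ (m - k - 1))) (at x)"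
    proof -
      have pow: "((\<lambda>x. x ^ Suc k) has_real_derivative real (Suc k) * x ^ k) (at x)"
        using DERIV_pow[of "Suc k" x] by simp
      have pow': "((\<lambda>x. (1 - x) ^ (m - k)) has_real_derivative
          - (real (m - k) * (1 - x) ^ (m - k - 1))) (at x)"
        by (auto intro!: derivative_eq_intros)
      from DERIV_cmult[OF DERIV_mult[OF pow pow'], of "real (Suc m choose Suc k)"]
      show ?thesis
        unfolding Bernstein_def by (simp only: diff_Suc_Suc) (simp add: algebra_simps)
    qed
    then show ?thesis
      unfolding 1 2 by (simp add: Bernstein_def algebra_simps)
  qed
  have tail: "binomial_tail (Suc m) p = (\<lambda>x. \<Sum>k\<in>{p..m}. Bernstein (Suc m) (Suc k) x)"
    unfolding binomial_tail_def
    by (intro ext sum.reindex_bij_witness[of _ Suc "\<lambda>k. k - 1"]) auto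
  have "(binomial_tail (Suc m) p has_real_derivative
      (\<Sum>k\<in>{p..m}. real (Suc m) * (Bernstein m k x - Bernstein m (Suc k) x))) (at x)"
    unfolding tail by (intro DERIV_sum der) auto
  also have "(\<Sum>k\<in>{p..m}. real (Suc m) * (Bernstein m k x - Bernstein m (Suc k) x)) =
      real (Suc m) * (Bernstein m p x - Bernstein m (Suc m) x)"
    using sum_Suc_diff[of p m "\<lambda>k. - Bernstein m k x"] assms
    by (simp flip: sum_distrib_left)
  also have "\<dots> = real (Suc m) * Bernstein m p x"
    by (simp add: Bernstein_def)
  finally show ?thesis .
qed

definition side_prob :: "real \<Rightarrow> real" where
  "side_prob v = v ^ 2 + (1 - v) ^ 2"

lemma side_prob_pos: "side_prob v > 0"
  unfolding side_prob_def using sum_power2_gt_zero_iff[of v "1 - v"] by auto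

text \<open>The substitution of \<open>a\<^sup>2 * side_prob v\<close> for the argument of the tail:
  its derivative \<open>2 * a * side_prob v\<close> absorbs the Jacobian \<open>a\<close>.\<close>

lemma inner_binomial_integral:
  assumes "p \<le> m"
  shows "((\<lambda>a. a * Bernstein m p (a\<^sup>2 * side_prob v)) has_integral
    binomial_tail (Suc m) p (side_prob v) / (2 * side_prob v * real (Suc m))) {0..1}"
proof -
  let ?F = "\<lambda>a. binomial_tail (Suc m) p (a\<^sup>2 * side_prob v) / (2 * side_prob v * real (Suc m))"
  have "((\<lambda>a. a * Bernstein m p (a\<^sup>2 * side_prob v)) has_integral ?F 1 - ?F 0) {0..1}"
  proof (intro fundamental_theorem_of_calculus)
    fix a :: real
    have sq: "((\<lambda>a. a\<^sup>2 * side_prob v) has_real_derivative 2 * a * side_prob v) (at a within {0..1})"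
      by (auto intro!: derivative_eq_intros)
    have "(?F has_real_derivative
        (real (Suc m) * Bernstein m p (a\<^sup>2 * side_prob v)) * (2 * a * side_prob v) / (2 * side_prob v * real (Suc m)))
        (at a within {0..1})"
      by (intro DERIV_cdivide DERIV_chain2[OF DERIV_binomial_tail[OF assms] sq])
    also have "(real (Suc m) * Bernstein m p (a\<^sup>2 * side_prob v)) * (2 * a * side_prob v) / (2 * side_prob v * real (Suc m)) =
        a * Bernstein m p (a\<^sup>2 * side_prob v)"
      using side_prob_pos[of v] by simp
    finally show "(?F has_vector_derivative a * Bernstein m p (a\<^sup>2 * side_prob v)) (at a within {0..1})"
      by (simp only: has_real_derivative_iff_has_vector_derivative)
  qed simp
  \<comment> \<open>The tail starts above \<open>p\<close>, so every summand has a positive power of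
    0.\<close>
  moreover have "binomial_tail (Suc m) p 0 = 0"
    by (simp add: binomial_tail_def Bernstein_def)
  ultimately show ?thesis by simp
qed

text \<open>For a fixed matching, summing the Dirichlet integrals over its admissible colourings
  gives an integral that does not depend on the matching. The number of matchings therefore cancels
  against the double factorial in \<open>X_dist\<close>.\<close>

lemma X_dist_has_integral:
  assumes "p \<le> m"
  shows "((\<lambda>v. binomial_tail (Suc m) p (side_prob v) / side_prob v) has_integral
    real (Suc m) * X_dist (Suc m) p) {0..1}"
proof -
  define A where "A = {1..2 * m}"
  have A: "finite A" "card A = 2 * m" by (auto simp: A_def)
  let ?C = "\<lambda>M. {c \<in> colourings A. card (monochromatic c M) = p}"
  have one: "((\<lambda>v. binomial_tail (Suc m) p (side_prob v) / (2 * side_prob v * real (Suc m))) has_integral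
      (\<Sum>c\<in>?C M. size_weight A c) / (real (2 * m + 1) * real (2 * m + 2))) {0..1}"
    if M: "M \<in> matchings A" for M
  proof -
    have UM: "\<Union>M = A" and disj: "disjoint M" and two: "\<And>e. e \<in> M \<Longrightarrow> card e = 2"
      using M by (auto simp: matchings_def partition_on_def)
    have finM: "finite M"
      using A(1) UM by (metis finite_UnionD)
    have cM: "card M = m"
      using card_matching[OF A(1) M] A(2) by simp
    \<comment> \<open>The three weights add up to 1, so the coloured sum is a Bernstein polynomial
      at the probability that a pair is monochromatic of colour 0 or 2.\<close>
    have eq: "a * Bernstein m p (a\<^sup>2 * side_prob v) = (\<Sum>c\<in>?C M. a * (\<Prod>x\<in>A. simplex_weight v a (c x)))"
      for a v
    proof -
      have "(a * v)\<^sup>2 + (a * (1 - v))\<^sup>2 = a\<^sup>2 * side_prob v"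
        by (simp only: side_prob_def power_mult_distrib distrib_left)
      moreover have "a * v + (1 - a) + a * (1 - v) = 1"
        by (simp add: algebra_simps)
      moreover have "simplex_weight v a 0 = a * v" "simplex_weight v a 1 = 1 - a"
        "simplex_weight v a 2 = a * (1 - v)"
        by (simp_all add: simplex_weight_def)
      ultimately show ?thesis
        using sum_colourings_monochromatic[OF finM disj two, where p = p and w = "simplex_weight v a"]
        unfolding UM cM sum_distrib_left[symmetric] Bernstein_def by (simp only: power_one)
    qed
    have sum: "((\<lambda>a. \<Sum>c\<in>?C M. a * (\<Prod>x\<in>A. simplex_weight v a (c x))) has_integral
        (\<Sum>c\<in>?C M. integral {0..1} (\<lambda>a. a * (\<Prod>x\<in>A. simplex_weight v a (c x))))) {0..1}" for v
      using A(1) inner_dirichlet_integral[OF A(1)]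
      by (intro has_integral_sum)
        (auto simp: finite_colourings intro!: integrable_integral)
    have "binomial_tail (Suc m) p (side_prob v) / (2 * side_prob v * real (Suc m)) =
        (\<Sum>c\<in>?C M. integral {0..1} (\<lambda>a. a * (\<Prod>x\<in>A. simplex_weight v a (c x))))" for v
      using inner_binomial_integral[OF assms, of v] sum[of v]
      unfolding eq by (rule has_integral_unique)
    moreover have "((\<lambda>v. \<Sum>c\<in>?C M. integral {0..1} (\<lambda>a. a * (\<Prod>x\<in>A. simplex_weight v a (c x))))
        has_integral (\<Sum>c\<in>?C M. size_weight A c / (real (card A + 1) * real (card A + 2)))) {0..1}"
      using A(1) by (intro has_integral_sum dirichlet_integral) (auto simp: finite_colourings)
    ultimately show ?thesis
      by (simp add: A(2) sum_divide_distrib)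
  qed
  let ?T = "\<lambda>v. binomial_tail (Suc m) p (side_prob v) / (2 * side_prob v * real (Suc m))"
  let ?I = "integral {0..1} ?T"
  have "real (X_count (Suc m) p) = (\<Sum>M\<in>matchings A. (real (2 * m + 1) * real (2 * m + 2)) * ?I)"
    unfolding X_count_eq_weighted_sum[OF A]
  proof (rule sum.cong)
    fix M assume "M \<in> matchings A"
    from integral_unique[OF one[OF this]]
    show "(\<Sum>c\<in>?C M. size_weight A c) = (real (2 * m + 1) * real (2 * m + 2)) * ?I"
      by (simp only: times_divide_eq_right nonzero_mult_div_cancel_left mult_eq_0_iff of_nat_eq_0_iff
          add_eq_0_iff_both_eq_0 one_neq_zero zero_neq_numeral[symmetric] simp_thms)
  qed simp
  also have "\<dots> = real (double_fact (2 * m - 1)) * (real (2 * m + 1) * real (2 * m + 2)) * ?I"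
    using card_matchings[OF A] by simp
  finally have count: "real (X_count (Suc m) p) = \<dots>" .
  have df: "double_fact (2 * Suc m - 1) = (2 * m + 1) * double_fact (2 * m - 1)"
    by (cases m) auto
  have dpos: "double_fact k > 0" for k
    by (induction k rule: double_fact.induct) auto
  \<comment> \<open>Some matching exists, so \<open>one\<close> provides the integrability of
    \<open>?T\<close>.\<close>
  obtain M where "M \<in> matchings A"
    using card_matchings[OF A] dpos[of "2 * m - 1"] by (metis all_not_in_conv card.empty less_irrefl)
  then have int: "?T integrable_on {0..1}"
    using one by blast
  \<comment> \<open>The constant is \<open>(2 * m + 1) * (2 * m + 2)\<close> divided by
    \<open>Suc m * (2 * m + 1)\<close>, the latter coming from the total number of
    configurations.\<close>
  have "X_dist (Suc m) p = 2 * ?I"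
  proof -
    have "d * (r * (2 * s)) * J / (s * (r * d)) = 2 * J" if "d \<noteq> 0" "r \<noteq> 0" "s \<noteq> 0" for d r s J :: real
      using that by simp
    note cancel = this
    have two: "real (2 * m + 2) = 2 * real (Suc m)" by simp
    show ?thesis
      unfolding X_dist_def count df of_nat_mult[of "Suc m"] of_nat_mult[of "2 * m + 1"] two
      using dpos[of "2 * m - 1"] by (intro cancel) auto
  qed
  moreover have "((\<lambda>v. (2 * real (Suc m)) * ?T v) has_integral (2 * real (Suc m)) * ?I) {0..1}"
    by (intro has_integral_mult_right integrable_integral int)
  moreover have "(\<lambda>v. (2 * real (Suc m)) * ?T v) = (\<lambda>v. binomial_tail (Suc m) p (side_prob v) / side_prob v)"
  proof
    have "(2 * s) * (t / (2 * q * s)) = t / q" if "s \<noteq> 0" for s t q :: real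
      using that by simp
    then show "(2 * real (Suc m)) * ?T v = binomial_tail (Suc m) p (side_prob v) / side_prob v" for v
      by (metis nat.distinct(1) of_nat_eq_0_iff)
  qed
  moreover have "(2 * real (Suc m)) * ?I = real (Suc m) * (2 * ?I)"
    by (simp only: mult_ac)
  ultimately show ?thesis by (simp only:)
qed

section \<open>Concentration of the binomial distribution\<close>

text \<open>Chebyshev's inequality: the variance is \<open>n * (q * (1 - q))\<close>, bounded
  crudely by \<open>n\<close>.\<close>

lemma Bernstein_deviation:
  assumes K: "K \<subseteq> {..n}" and q: "0 \<le> q" "q \<le> 1" and "0 < n" "0 < \<delta>"
    and dev: "\<And>k. k \<in> K \<Longrightarrow> \<bar>real k - n * q\<bar> \<ge> n * \<delta>"
  shows "(\<Sum>k\<in>K. Bernstein n k q) \<le> 1 / (n * \<delta>\<^sup>2)"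
proof -
  \<comment> \<open>The centred square is expressed through factorial moments, whose Bernstein sums
    are known in closed form.\<close>
  have expand: "(a - b)\<^sup>2 * x = a * (a - 1) * x + (1 - 2 * b) * (a * x) + b * b * x" for a b x :: real
    by (simp add: algebra_simps power2_eq_square)
  have "(\<Sum>k\<le>n. (real k - n * q)\<^sup>2 * Bernstein n k q) =
      real n * (real n - 1) * q\<^sup>2 + (1 - 2 * (n * q)) * (n * q) + n * q * (n * q)"
    unfolding expand sum.distrib sum_distrib_left[symmetric] by simp
  also have "\<dots> = n * (q * (1 - q))"
    by (simp add: algebra_simps power2_eq_square)
  finally have var: "(\<Sum>k\<le>n. (real k - n * q)\<^sup>2 * Bernstein n k q) = n * (q * (1 - q))" .
  have "(\<Sum>k\<in>K. (n * \<delta>)\<^sup>2 * Bernstein n k q) \<le> (\<Sum>k\<in>K. (real k - n * q)\<^sup>2 * Bernstein n k q)"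
  proof (intro sum_mono mult_right_mono Bernstein_nonneg q)
    fix k assume "k \<in> K"
    from power_mono[OF dev[OF this], of 2] show "(n * \<delta>)\<^sup>2 \<le> (real k - n * q)\<^sup>2"
      using assms by simp
  qed
  also have "\<dots> \<le> (\<Sum>k\<le>n. (real k - n * q)\<^sup>2 * Bernstein n k q)"
    using K q by (intro sum_mono2) (auto intro!: mult_nonneg_nonneg Bernstein_nonneg)
  also have "\<dots> \<le> real n * 1"
    unfolding var using q by (intro mult_left_mono mult_le_one) auto
  finally have "(n * \<delta>)\<^sup>2 * (\<Sum>k\<in>K. Bernstein n k q) \<le> n"
    by (simp add: sum_distrib_left)
  then show ?thesis
    using assms by (simp add: field_simps power2_eq_square)
qed

lemma binomial_tail_bounds:
  assumes "0 \<le> q" "q \<le> 1"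
  shows "0 \<le> binomial_tail n p q" "binomial_tail n p q \<le> 1"
proof -
  show "0 \<le> binomial_tail n p q"
    unfolding binomial_tail_def using assms by (intro sum_nonneg Bernstein_nonneg)
  have "binomial_tail n p q \<le> (\<Sum>k\<le>n. Bernstein n k q)"
    unfolding binomial_tail_def using assms by (intro sum_mono2) (auto intro: Bernstein_nonneg)
  then show "binomial_tail n p q \<le> 1" by simp
qed

text \<open>The weak law of large numbers with a moving threshold. At \<open>q = x\<close> the limit
  would depend on how \<open>p n / n\<close> approaches \<open>x\<close>, hence the
  exception.\<close>

lemma binomial_tail_limit:
  assumes p: "(\<lambda>n. real (p n) / real n) \<longlonglongrightarrow> x" and q: "0 \<le> q" "q \<le> 1" "q \<noteq> x"
  shows "(\<lambda>n. binomial_tail n (p n) q) \<longlonglongrightarrow> (if x < q then 1 else 0)"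
proof -
  \<comment> \<open>Half the distance: once \<open>p n / n\<close> is within this of
    \<open>x\<close>, it stays at least this far from \<open>q\<close>.\<close>
  define \<delta> where "\<delta> = \<bar>x - q\<bar> / 2"
  have \<delta>: "\<delta> > 0" using q by (simp add: \<delta>_def)
  have "\<forall>\<^sub>F n in sequentially. dist (real (p n) / real n) x < \<delta>"
    using tendstoD[OF p \<delta>] .
  then have "\<forall>\<^sub>F n in sequentially.
      \<bar>binomial_tail n (p n) q - (if x < q then 1 else 0)\<bar> \<le> 1 / (real n * \<delta>\<^sup>2)"
    using eventually_gt_at_top[of 0]
  proof eventually_elim
    case (elim n)
    note n = \<open>0 < n\<close>
    show ?case
    proof (cases "x < q")
      case True
      have "real (p n) / n < q - \<delta>"
        using elim(1) True unfolding \<delta>_def dist_real_def abs_less_iff by (simp add: field_simps)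
      then have pn: "real (p n) < n * q - n * \<delta>"
        using n by (subst (asm) pos_divide_less_eq) (auto simp: algebra_simps)
      have "real (p n) \<le> n * 1"
      proof -
        have "n * q \<le> real n * 1" using q by (intro mult_left_mono) auto
        moreover have "0 \<le> n * \<delta>" using \<delta> by simp
        ultimately show ?thesis using pn by simp
      qed
      then have le: "p n \<le> n" by simp
      \<comment> \<open>The left side is 1, so the distance of the tail from 1 is the lower sum, to
        which the deviation bound applies.\<close>
      have "(\<Sum>k\<le>n. Bernstein n k q) = (\<Sum>k\<le>p n. Bernstein n k q) + binomial_tail n (p n) q"
      proof -
        have "{..n} = {..p n} \<union> {p n<..n}" using le by auto
        then show ?thesis
          unfolding binomial_tail_def by (subst sum.union_disjoint[symmetric]) auto
      qed
      moreover have "(\<Sum>k\<le>p n. Bernstein n k q) \<le> 1 / (n * \<delta>\<^sup>2)"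
      proof (rule Bernstein_deviation)
        fix k assume "k \<in> {..p n}"
        then have "real k \<le> p n" by simp
        then show "n * \<delta> \<le> \<bar>real k - n * q\<bar>" using pn by linarith
      qed (use q n \<delta> le in auto)
      ultimately show ?thesis
        using True binomial_tail_bounds(2)[OF q(1,2), of n "p n"] by simp
    next
      case False
      have "real (p n) / n > q + \<delta>"
        using elim(1) False q(3) unfolding \<delta>_def dist_real_def abs_less_iff by (simp add: field_simps)
      then have pn: "real (p n) > n * q + n * \<delta>"
        using n by (subst (asm) pos_less_divide_eq) (auto simp: algebra_simps)
      have "binomial_tail n (p n) q \<le> 1 / (n * \<delta>\<^sup>2)"
        unfolding binomial_tail_def
      proof (rule Bernstein_deviation)
        fix k assume "k \<in> {p n<..n}"
        then have "real (p n) \<le> k" by simp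
        then show "n * \<delta> \<le> \<bar>real k - n * q\<bar>" using pn by linarith
      qed (use q n \<delta> in auto)
      then show ?thesis
        using False binomial_tail_bounds(1)[OF q(1,2), of n "p n"] by simp
    qed
  qed
  moreover have "(\<lambda>n. 1 / (real n * \<delta>\<^sup>2)) \<longlonglongrightarrow> 0"
    using tendsto_mult_left[OF lim_1_over_n, of "1 / \<delta>\<^sup>2"] by (simp add: field_simps)
  ultimately have "(\<lambda>n. binomial_tail n (p n) q - (if x < q then 1 else 0)) \<longlonglongrightarrow> 0"
    unfolding real_norm_def[symmetric] by (rule Lim_null_comparison)
  then show ?thesis
    by (rule LIM_zero_cancel)
qed

section \<open>The limiting integral\<close>

text \<open>Completing the square explains the threshold 1/2, the arctangent and the root of
  \<open>2 * x - 1\<close> in the result.\<close>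

lemma side_prob_eq: "side_prob v = (1 + (2 * v - 1)\<^sup>2) / 2"
  by (simp add: side_prob_def power2_eq_square field_simps)

lemma side_prob_ge: "1 / 2 \<le> side_prob v"
  by (simp add: side_prob_eq)

lemma side_prob_le_1:
  assumes "v \<in> {0..1}"
  shows "side_prob v \<le> 1"
  using assms abs_square_le_1[of "2 * v - 1"] by (auto simp: side_prob_eq)

text \<open>These are the points where convergence of the tail is left open; being finitely many,
  they do not affect integrals.\<close>

lemma finite_side_prob_fibre: "finite {v. side_prob v = x}"
proof (rule finite_subset)
  show "{v. side_prob v = x} \<subseteq> {(1 + sqrt (2 * x - 1)) / 2, (1 - sqrt (2 * x - 1)) / 2}"
  proof
    fix v assume "v \<in> {v. side_prob v = x}"
    then have "2 * x - 1 = (2 * v - 1)\<^sup>2"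
      by (auto simp: side_prob_eq)
    then have "sqrt (2 * x - 1) = \<bar>2 * v - 1\<bar>"
      by simp
    then show "v \<in> {(1 + sqrt (2 * x - 1)) / 2, (1 - sqrt (2 * x - 1)) / 2}"
      by (auto simp: abs_if)
  qed
qed simp

lemma inverse_side_prob_integral:
  assumes "a \<le> b"
  shows "((\<lambda>v. 1 / side_prob v) has_integral arctan (2 * b - 1) - arctan (2 * a - 1)) {a..b}"
proof (rule fundamental_theorem_of_calculus[OF assms])
  fix v
  have "((\<lambda>v. arctan (2 * v - 1)) has_real_derivative 2 / (1 + (2 * v - 1)\<^sup>2)) (at v within {a..b})"
    by (auto intro!: derivative_eq_intros simp: divide_inverse)
  then show "((\<lambda>v. arctan (2 * v - 1)) has_vector_derivative 1 / side_prob v) (at v within {a..b})"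
    by (simp add: side_prob_eq has_real_derivative_iff_has_vector_derivative)
qed

text \<open>Below 1/2 the condition always holds and the value is
  \<open>arctan 1 - arctan (- 1)\<close>. Otherwise, with \<open>c = sqrt (2 * x - 1)\<close>, it
  holds on two outer intervals, each contributing \<open>pi / 4 - arctan c\<close>.\<close>

lemma limit_integral:
  assumes "x \<le> 1"
  shows "((\<lambda>v. if x < side_prob v then 1 / side_prob v else 0) has_integral
    (if x < 1/2 then pi / 2 else pi / 2 - 2 * arctan (sqrt (2 * x - 1)))) {0..1}"
proof (cases "x < 1/2")
  case True
  then have "x < side_prob v" for v
    using side_prob_ge[of v] by simp
  then show ?thesis
    using inverse_side_prob_integral[of 0 1] True by (simp add: arctan_minus)
next
  case False
  define c where "c = sqrt (2 * x - 1)"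
  have c: "0 \<le> c" "c \<le> 1" "c\<^sup>2 = 2 * x - 1"
    using False assms by (auto simp: c_def)
  have lt: "x < side_prob v \<longleftrightarrow> c < \<bar>2 * v - 1\<bar>" for v
  proof -
    have "x < side_prob v \<longleftrightarrow> c\<^sup>2 < (2 * v - 1)\<^sup>2"
      by (auto simp: side_prob_eq c(3))
    also have "\<dots> \<longleftrightarrow> c < \<bar>2 * v - 1\<bar>"
      using c(1) abs_le_square_iff[of "2 * v - 1" c] by (simp flip: not_le)
    finally show ?thesis .
  qed
  let ?g = "\<lambda>v. if x < side_prob v then 1 / side_prob v else 0"
  let ?a = "(1 - c) / 2" and ?b = "(1 + c) / 2"
  \<comment> \<open>The inequality in \<open>?g\<close> is strict and fails at \<open>?a\<close>, so
    this endpoint is discarded as a single point.\<close>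
  have left: "(?g has_integral arctan (2 * ?a - 1) - arctan (2 * 0 - 1)) {0..?a}"
    using c by (intro has_integral_spike_finite[OF _ _ inverse_side_prob_integral, of "{?a}"]) (auto simp: lt)
  have mid: "(?g has_integral 0) {?a..?b}"
    using c by (intro has_integral_is_0) (auto simp: lt abs_if field_simps)
  have right: "(?g has_integral arctan (2 * 1 - 1) - arctan (2 * ?b - 1)) {?b..1}"
    using c by (intro has_integral_spike_finite[OF _ _ inverse_side_prob_integral, of "{?b}"]) (auto simp: lt)
  have "(?g has_integral (arctan (2 * ?a - 1) - arctan (2 * 0 - 1)) + 0 +
      (arctan (2 * 1 - 1) - arctan (2 * ?b - 1))) {0..1}"
    using c by (intro has_integral_combine[OF _ _ has_integral_combine[OF _ _ left mid] right]) auto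
  moreover have "2 * ?a - 1 = - c" "2 * ?b - 1 = c"
    by (auto simp: field_simps)
  ultimately show ?thesis
    using False by (simp add: arctan_minus flip: c_def)
qed

section \<open>Passage to the limit by dominated convergence\<close>

theorem theorem26:
  fixes x :: real and p :: "nat \<Rightarrow> nat"
  assumes "0 \<le> x" and "x \<le> 1"
    and "\<And>n. n \<ge> 1 \<Longrightarrow> p n \<le> n - 1"
    and "(\<lambda>n. real (p n) / (real n - 1)) \<longlonglongrightarrow> x"
  shows "(\<lambda>n. (real n - 1) * X_dist n (p n)) \<longlonglongrightarrow>
    (if x < 1/2 then pi / 2 else pi / 2 - 2 * arctan (sqrt (2 * x - 1)))"
proof -
  let ?L = "if x < 1/2 then pi / 2 else pi / 2 - 2 * arctan (sqrt (2 * x - 1))"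
  let ?f = "\<lambda>m v. binomial_tail (Suc m) (p (Suc m)) (side_prob v) / side_prob v"
  \<comment> \<open>Setting the integrand to 0 on the exceptional fibre, where \<open>?g\<close> is
    0 too, gives convergence at every point.\<close>
  let ?h = "\<lambda>m v. if side_prob v = x then 0 else ?f m v"
  let ?g = "\<lambda>v. if x < side_prob v then 1 / side_prob v else 0"
  \<comment> \<open>The integral formula is normalised by \<open>n\<close>, the theorem by
    \<open>n - 1\<close>; this ratio converts both the argument \<open>x\<close> and the final
    factor.\<close>
  have ratio: "(\<lambda>n. (real n - 1) / real n) \<longlonglongrightarrow> 1"
    by real_asymp
  have "(\<lambda>n. real (p n) / (real n - 1) * ((real n - 1) / real n)) \<longlonglongrightarrow> x * 1"
    by (intro tendsto_mult assms(4) ratio)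
  then have "(\<lambda>n. real (p n) / (real n - 1) * ((real n - 1) / real n)) \<longlonglongrightarrow> x"
    by simp
  moreover have "\<forall>\<^sub>F n in sequentially. real (p n) / (real n - 1) * ((real n - 1) / real n) = real (p n) / real n"
    using eventually_gt_at_top[of 1] by eventually_elim auto
  ultimately have px: "(\<lambda>n. real (p n) / real n) \<longlonglongrightarrow> x"
    by (rule Lim_transform_eventually)
  have int: "(?h m has_integral real (Suc m) * X_dist (Suc m) (p (Suc m))) {0..1}" for m
  proof (rule has_integral_spike_finite[OF finite_side_prob_fibre[of x]])
    show "(?f m has_integral real (Suc m) * X_dist (Suc m) (p (Suc m))) {0..1}"
      using assms(3)[of "Suc m"] by (intro X_dist_has_integral) simp
  qed simp
  have "(\<lambda>m. integral {0..1} (?h m)) \<longlonglongrightarrow> integral {0..1} ?g"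
  proof (rule dominated_convergence(2))
    show "?h m integrable_on {0..1}" for m
      using int by blast
    \<comment> \<open>The dominating constant is 2 because the tail is at most 1 and
      \<open>side_prob\<close> at least 1/2.\<close>
    show "(\<lambda>v::real. 2::real) integrable_on {0..1}"
      by (rule integrable_const_ivl)
    show "norm (?h m v) \<le> 2" if "v \<in> {0..1}" for m v
    proof -
      note b = binomial_tail_bounds[OF less_imp_le[OF side_prob_pos] side_prob_le_1[OF that]]
      have "?f m v \<le> 1 / (1 / 2)"
        using b side_prob_ge[of v] by (intro frac_le) simp_all
      moreover have "0 \<le> ?f m v"
        using b side_prob_pos[of v] by simp
      ultimately show ?thesis
        by simp
    qed
    show "(\<lambda>m. ?h m v) \<longlonglongrightarrow> ?g v" if "v \<in> {0..1}" for v
    proof (cases "side_prob v = x")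
      case False
      have "(\<lambda>m. binomial_tail (Suc m) (p (Suc m)) (side_prob v)) \<longlonglongrightarrow> (if x < side_prob v then 1 else 0)"
        using binomial_tail_limit[OF px less_imp_le[OF side_prob_pos] side_prob_le_1[OF that] False]
        by (rule LIMSEQ_Suc)
      then have "(\<lambda>m. binomial_tail (Suc m) (p (Suc m)) (side_prob v) / side_prob v) \<longlonglongrightarrow>
          (if x < side_prob v then 1 else 0) / side_prob v"
        by (rule tendsto_divide[OF _ tendsto_const]) (use side_prob_pos[of v] in simp)
      then show ?thesis
        using False by (simp split: if_splits)
    qed simp
  qed
  then have "(\<lambda>m. real (Suc m) * X_dist (Suc m) (p (Suc m))) \<longlonglongrightarrow> ?L"
    using integral_unique[OF int] integral_unique[OF limit_integral[OF assms(2)]] by simp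
  then have "(\<lambda>n. real n * X_dist n (p n)) \<longlonglongrightarrow> ?L"
    by (rule LIMSEQ_imp_Suc)
  from tendsto_mult[OF this ratio]
  have "(\<lambda>n. real n * X_dist n (p n) * ((real n - 1) / real n)) \<longlonglongrightarrow> ?L"
    by simp
  moreover have "\<forall>\<^sub>F n in sequentially.
      real n * X_dist n (p n) * ((real n - 1) / real n) = (real n - 1) * X_dist n (p n)"
    using eventually_gt_at_top[of 0] by eventually_elim auto
  ultimately show ?thesis
    by (rule Lim_transform_eventually)
qed

end
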